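(* Let $m\ge 1$ be an integer and let $X_1,\dots,X_n$ be any instance of the prophet problem, consisting of independent continuous random variables (either identically distributed or not necessarily identically distributed). Then the largest probability of selecting the maximum realization $\max_i X_i$ that can be achieved on this instance by an algorithm in the oracle model with $m$ oracle calls (and one selection) equals the largest probability of selecting the maximum realization that can be achieved on this instance by an algorithm in the Top-$1$-of-$(m+1)$ model.
   Context: Prophet problem: $X_1,\dots,X_n$ are independent random variables with known distributions. Their realizations are revealed one at a time, in the order $X_1,\dots,X_n$; decisions are online and irrevocable. "Largest probability achieved" means the supremum over all online algorithms in the model. Oracle model with $m$ calls ($\mathcal{O}_m$): the algorithm may select at most one value, immediately when it is observed. In addition, at most $m$ times during the process, after observing the current realization $X_i$ and before deciding whether to select it, it may query an oracle, which answers YES if $X_i>\max_{j=i+1}^n X_j$ and NO otherwise. The algorithm succeeds if the value it selects equals $\max_i X_i$. Top-$1$-of-$k$ model ($\textsc{Proph}_k$): there is no oracle; the algorithm may irrevocably select up to $k$ values (each at the time it is observed), and its output is the maximum of the selected values. It succeeds if this output equals $\max_i X_i$. *)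

theory Defs
  imports "HOL-Probability.Probability"
begin

text \<open>
  The values are indexed by \<open>1..n\<close>; a vector of realizations is a function
  \<open>x :: nat \<Rightarrow> real\<close>, of which only \<open>x 1, \<dots>, x n\<close> matter. A decision at time \<open>i\<close> is made by a
  rule that receives \<open>restrict x {1..i}\<close>, so it cannot look ahead.

  Algorithms may be randomized: every rule also receives a seed \<open>s\<close>, drawn once from a probability
  space \<open>R\<close> independently of the values. Deterministic algorithms are the case of a
  one-point \<open>R\<close>. Rules may depend arbitrarily on the (known) distributions, since the optimal
  success probabilities below are suprema taken separately for each instance.
\<close>

type_synonym history = "nat \<Rightarrow> real"

abbreviation history_space :: "nat \<Rightarrow> history measure" where
  "history_space i \<equiv> Pi\<^sub>M {1..i} (\<lambda>_. borel)"


section \<open>Oracle model\<close>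

text \<open>The maximum over the empty set (\<open>i = n\<close>) is read as minus infinity: the answer is then YES.\<close>

definition oracle_answer :: "nat \<Rightarrow> (nat \<Rightarrow> real) \<Rightarrow> nat \<Rightarrow> bool" where
  "oracle_answer n x i \<longleftrightarrow> (\<forall>j\<in>{i<..n}. x j < x i)"

text \<open>
  A rule is applied to the time, the seed, the values observed so far and the oracle transcript.
  The transcript has one entry per elapsed time step: \<open>None\<close> if the oracle was not queried at that
  step, \<open>Some b\<close> if it was queried and answered \<open>b\<close>. At time \<open>i\<close> the query rule sees the \<open>i - 1\<close>
  entries of the earlier steps, while the selection rule also sees the entry of step \<open>i\<close>.
\<close>

type_synonym 's oracle_rule = "nat \<Rightarrow> 's \<Rightarrow> history \<Rightarrow> bool option list \<Rightarrow> bool"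

primrec transcript ::
    "'s oracle_rule \<Rightarrow> nat \<Rightarrow> 's \<Rightarrow> (nat \<Rightarrow> real) \<Rightarrow> nat \<Rightarrow> bool option list" where
  "transcript q n s x 0 = []"
| "transcript q n s x (Suc i) =
     transcript q n s x i @
     [if q (Suc i) s (restrict x {1..Suc i}) (transcript q n s x i)
      then Some (oracle_answer n x (Suc i)) else None]"

definition oracle_queries ::
    "'s oracle_rule \<Rightarrow> nat \<Rightarrow> 's \<Rightarrow> (nat \<Rightarrow> real) \<Rightarrow> nat set" where
  "oracle_queries q n s x =
     {i \<in> {1..n}. q i s (restrict x {1..i}) (transcript q n s x (i - 1))}"

definition oracle_selected ::
    "'s oracle_rule \<Rightarrow> 's oracle_rule \<Rightarrow> nat \<Rightarrow> 's \<Rightarrow> (nat \<Rightarrow> real) \<Rightarrow> nat set" where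
  "oracle_selected q a n s x =
     {i \<in> {1..n}. a i s (restrict x {1..i}) (transcript q n s x i)}"

definition oracle_algorithm ::
    "'s measure \<Rightarrow> nat \<Rightarrow> nat \<Rightarrow> 's oracle_rule \<Rightarrow> 's oracle_rule \<Rightarrow> bool" where
  "oracle_algorithm R n m q a \<longleftrightarrow>
     (\<forall>i\<in>{1..n}. \<forall>t.
        (\<lambda>(s, h). q i s h t) \<in> R \<Otimes>\<^sub>M history_space i \<rightarrow>\<^sub>M count_space UNIV \<and>
        (\<lambda>(s, h). a i s h t) \<in> R \<Otimes>\<^sub>M history_space i \<rightarrow>\<^sub>M count_space UNIV) \<and>
     (\<forall>s\<in>space R. \<forall>x.
        card (oracle_queries q n s x) \<le> m \<and> card (oracle_selected q a n s x) \<le> 1)"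

definition oracle_success ::
    "'s oracle_rule \<Rightarrow> 's oracle_rule \<Rightarrow> nat \<Rightarrow> 's \<Rightarrow> (nat \<Rightarrow> real) \<Rightarrow> bool" where
  "oracle_success q a n s x \<longleftrightarrow> (\<exists>i\<in>oracle_selected q a n s x. x i = Max (x ` {1..n}))"

definition oracle_value ::
    "'s measure \<Rightarrow> 'a measure \<Rightarrow> (nat \<Rightarrow> 'a \<Rightarrow> real) \<Rightarrow> nat \<Rightarrow> nat \<Rightarrow> real" where
  "oracle_value R M X n m =
     Sup {\<P>((s, \<omega>) in R \<Otimes>\<^sub>M M. oracle_success q a n s (\<lambda>i. X i \<omega>)) | q a.
            oracle_algorithm R n m q a}"


section \<open>Top-1-of-k model\<close>

type_synonym 's top1_rule = "nat \<Rightarrow> 's \<Rightarrow> history \<Rightarrow> bool"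

definition top1_selected :: "'s top1_rule \<Rightarrow> nat \<Rightarrow> 's \<Rightarrow> (nat \<Rightarrow> real) \<Rightarrow> nat set" where
  "top1_selected a n s x = {i \<in> {1..n}. a i s (restrict x {1..i})}"

definition top1_algorithm :: "'s measure \<Rightarrow> nat \<Rightarrow> nat \<Rightarrow> 's top1_rule \<Rightarrow> bool" where
  "top1_algorithm R n k a \<longleftrightarrow>
     (\<forall>i\<in>{1..n}. (\<lambda>(s, h). a i s h) \<in> R \<Otimes>\<^sub>M history_space i \<rightarrow>\<^sub>M count_space UNIV) \<and>
     (\<forall>s\<in>space R. \<forall>x. card (top1_selected a n s x) \<le> k)"

text \<open>A run that selects nothing has no output and does not succeed.\<close>

definition top1_success :: "'s top1_rule \<Rightarrow> nat \<Rightarrow> 's \<Rightarrow> (nat \<Rightarrow> real) \<Rightarrow> bool" where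
  "top1_success a n s x \<longleftrightarrow>
     top1_selected a n s x \<noteq> {} \<and> Max (x ` top1_selected a n s x) = Max (x ` {1..n})"

definition top1_value ::
    "'s measure \<Rightarrow> 'a measure \<Rightarrow> (nat \<Rightarrow> 'a \<Rightarrow> real) \<Rightarrow> nat \<Rightarrow> nat \<Rightarrow> real" where
  "top1_value R M X n k =
     Sup {\<P>((s, \<omega>) in R \<Otimes>\<^sub>M M. top1_success a n s (\<lambda>i. X i \<omega>)) | a. top1_algorithm R n k a}"

end

theory Submission imports Defs begin

text \<open>
  The two models simulate each other, seed by seed and realization by realization.

  A Top-1-of-\<open>(m + 1)\<close> algorithm may imitate an oracle algorithm by selecting every value that is
  queried or selected and continuing as if each answer were NO. The first YES falls on a value
  exceeding all later ones, so the maximum has then been observed: any later selection of the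
  oracle algorithm fails, and if it selects the maximum, all earlier answers were really NO.

  Conversely an oracle algorithm may query the first \<open>m\<close> values which a Top-1-of-\<open>(m + 1)\<close> algorithm
  selects, keep the first one that receives YES, and otherwise keep the \<open>(m + 1)\<close>-st. Since the
  oracle compares strictly, this may fail on ties, which continuity makes a null event.
\<close>

declare One_nat_def [simp del]

section \<open>Capping the number of selections\<close>

text \<open>Earlier selections of \<open>g\<close> itself are counted, not those of the capped rule,
  which avoids a recursion. The effect is to keep exactly the first \<open>k\<close> selections of
  \<open>g\<close>.\<close>

definition cap :: "nat \<Rightarrow> 's top1_rule \<Rightarrow> 's top1_rule" where
  "cap k g i s h \<longleftrightarrow> g i s h \<and> card (top1_selected g (i - 1) s h) < k"

lemma restrict_history:
  fixes x :: "nat \<Rightarrow> real"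
  assumes "j \<le> i"
  shows "restrict (restrict x {1..i}) {1..j} = restrict x {1..j}"
proof -
  have "{1..i} \<inter> {1..j} = {1..j}" using assms by auto
  then show ?thesis by (simp only: restrict_restrict)
qed

lemma finite_top1_selected [simp]: "finite (top1_selected a n s x)"
  by (simp add: top1_selected_def)

lemma top1_selected_restrict:
  assumes "k \<le> i"
  shows "top1_selected a k s (restrict x {1..i}) = top1_selected a k s x"
  using assms by (auto simp: top1_selected_def restrict_history simp del: restrict_restrict)

lemma cap_restrict:
  "cap k g i s (restrict x {1..i}) \<longleftrightarrow>
    g i s (restrict x {1..i}) \<and> card (top1_selected g (i - 1) s x) < k"
  unfolding cap_def by (subst top1_selected_restrict) auto

text \<open>The number of earlier selections ranks the selected times: \<open>i\<close> is counted
  at \<open>j\<close> but not at \<open>i\<close>.\<close>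

lemma card_prev_less:
  assumes "i \<in> top1_selected g n s x" "i < j"
  shows "card (top1_selected g (i - 1) s x) < card (top1_selected g (j - 1) s x)"
proof (rule psubset_card_mono)
  have "i \<in> top1_selected g (j - 1) s x" "i \<notin> top1_selected g (i - 1) s x"
    and "top1_selected g (i - 1) s x \<subseteq> top1_selected g (j - 1) s x"
    using assms by (auto simp: top1_selected_def)
  then show "top1_selected g (i - 1) s x \<subset> top1_selected g (j - 1) s x" by blast
qed simp

lemma card_prev_less_total:
  assumes "i \<in> top1_selected g n s x"
  shows "card (top1_selected g (i - 1) s x) < card (top1_selected g n s x)"
proof -
  \<comment> \<open>The end of the process is treated as time \<open>Suc n\<close>, before which all
    \<open>n\<close> values have passed.\<close>
  have "i \<in> top1_selected g (Suc n) s x" "i < Suc n"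
    using assms by (auto simp: top1_selected_def)
  then show ?thesis
    using card_prev_less[of i g "Suc n" s x "Suc n"] by simp
qed

text \<open>Rank injects the kept times into \<open>{..<k}\<close>. As \<open>g\<close> is
  arbitrary, the bound holds for every seed and every vector.\<close>

lemma card_cap_le: "card (top1_selected (cap k g) n s x) \<le> k"
proof -
  let ?c = "\<lambda>i. card (top1_selected g (i - 1) s x)"
  have sel: "i \<in> top1_selected g n s x \<and> ?c i < k" if "i \<in> top1_selected (cap k g) n s x" for i
    using that by (auto simp: top1_selected_def[of _ n] cap_restrict)
  have "inj_on ?c (top1_selected (cap k g) n s x)"
    by (rule inj_onI) (metis sel card_prev_less less_irrefl linorder_neqE_nat)
  moreover have "?c ` top1_selected (cap k g) n s x \<subseteq> {..<k}"
    using sel by auto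
  ultimately show ?thesis
    using card_inj_on_le[of ?c _ "{..<k}"] by simp
qed


section \<open>Transcripts for arbitrary answers\<close>

text \<open>Separating the transcript from the true oracle allows a comparison with the constant
  answer NO, which can be computed without looking ahead.\<close>

primrec run ::
    "'s oracle_rule \<Rightarrow> (nat \<Rightarrow> bool) \<Rightarrow> 's \<Rightarrow> (nat \<Rightarrow> real) \<Rightarrow> nat \<Rightarrow> bool option list" where
  "run q ans s x 0 = []"
| "run q ans s x (Suc i) =
     run q ans s x i @
     [if q (Suc i) s (restrict x {1..Suc i}) (run q ans s x i) then Some (ans (Suc i)) else None]"

lemma transcript_eq_run: "transcript q n s x i = run q (oracle_answer n x) s x i"
  by (induction i) auto

lemma run_restrict: "i \<le> k \<Longrightarrow> run q ans s (restrict x {1..k}) i = run q ans s x i"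
  by (induction i) (auto simp: restrict_history simp del: restrict_restrict)

text \<open>Answers enter a transcript only at queried times.\<close>

lemma run_cong:
  assumes "\<And>j. 1 \<le> j \<Longrightarrow> j \<le> i \<Longrightarrow> q j s (restrict x {1..j}) (run q ans s x (j - 1)) \<Longrightarrow> ans j = ans' j"
  shows "run q ans s x i = run q ans' s x i"
  using assms
proof (induction i)
  case (Suc i)
  then have "run q ans s x i = run q ans' s x i" by simp
  with Suc.prems[of "Suc i"] show ?case by (auto simp del: restrict_apply)
qed simp

lemma run_prefix: "i \<le> j \<Longrightarrow> set (run q ans s x i) \<subseteq> set (run q ans s x j)"
  by (induction j) (auto simp: le_Suc_eq)

lemma run_last:
  assumes "1 \<le> i"
  shows "run q ans s x i = run q ans s x (i - 1) @
    [if q i s (restrict x {1..i}) (run q ans s x (i - 1)) then Some (ans i) else None]"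
  using assms by (cases i) auto

lemma Some_True_in_run:
  "Some True \<in> set (run q ans s x i) \<Longrightarrow> \<exists>j\<in>{1..i}. ans j"
proof (induction i)
  case (Suc i)
  show ?case
  proof (cases "Some True \<in> set (run q ans s x i)")
    case True
    then obtain j where "j \<in> {1..i}" "ans j" using Suc.IH by blast
    then show ?thesis by (intro bexI[of _ j]) auto
  next
    case False
    then have "ans (Suc i)" using Suc.prems by (auto split: if_splits)
    then show ?thesis by (intro bexI[of _ "Suc i"]) auto
  qed
qed simp


section \<open>Measurability\<close>

text \<open>The space \<open>N\<close> is general because two cases are needed: pairs of a seed and
  a history, and the product of the seeds with the outcomes, where \<open>X\<close> lives.\<close>

lemma pred_rule:
  assumes b: "(\<lambda>(s, h). b s h) \<in> R \<Otimes>\<^sub>M history_space i \<rightarrow>\<^sub>M count_space UNIV"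
    and f: "f \<in> N \<rightarrow>\<^sub>M R"
    and g: "\<And>j. j \<in> {1..i} \<Longrightarrow> (\<lambda>\<omega>. g \<omega> j) \<in> borel_measurable N"
  shows "Measurable.pred N (\<lambda>\<omega>. b (f \<omega>) (restrict (g \<omega>) {1..i}))"
proof -
  have "(\<lambda>\<omega>. (f \<omega>, restrict (g \<omega>) {1..i})) \<in> N \<rightarrow>\<^sub>M R \<Otimes>\<^sub>M history_space i"
    by (intro measurable_Pair f measurable_restrict g)
  from measurable_compose[OF this b] show ?thesis by simp
qed

lemma measurable_card_top1_selected:
  assumes a: "\<And>i. i \<in> {1..n} \<Longrightarrow>
      (\<lambda>(s, h). a i s h) \<in> R \<Otimes>\<^sub>M history_space i \<rightarrow>\<^sub>M count_space UNIV"
    and f: "f \<in> N \<rightarrow>\<^sub>M R"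
    and g: "\<And>j. j \<in> {1..n} \<Longrightarrow> (\<lambda>\<omega>. g \<omega> j) \<in> borel_measurable N"
  shows "(\<lambda>\<omega>. card (top1_selected a n (f \<omega>) (g \<omega>))) \<in> N \<rightarrow>\<^sub>M count_space UNIV"
proof (rule measurable_card)
  fix i
  show "{\<omega> \<in> space N. i \<in> top1_selected a n (f \<omega>) (g \<omega>)} \<in> sets N"
  proof (cases "i \<in> {1..n}")
    case True
    have "Measurable.pred N (\<lambda>\<omega>. a i (f \<omega>) (restrict (g \<omega>) {1..i}))"
      by (rule pred_rule[OF a[OF True] f g]) (use True in simp)
    then have "{\<omega> \<in> space N. a i (f \<omega>) (restrict (g \<omega>) {1..i})} \<in> sets N"
      by (simp only: pred_def)
    with True show ?thesis by (simp only: top1_selected_def mem_Collect_eq simp_thms)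
  next
    case False
    then have "i \<notin> top1_selected a n (f \<omega>) (g \<omega>)" for \<omega>
      unfolding top1_selected_def by blast
    then show ?thesis by simp
  qed
qed

lemma measurable_cap:
  assumes a: "\<And>i. i \<in> {1..n} \<Longrightarrow>
      (\<lambda>(s, h). a i s h) \<in> R \<Otimes>\<^sub>M history_space i \<rightarrow>\<^sub>M count_space UNIV"
    and i: "i \<in> {1..n}"
  shows "(\<lambda>(s, h). cap k a i s h) \<in> R \<Otimes>\<^sub>M history_space i \<rightarrow>\<^sub>M count_space UNIV"
proof -
  have [measurable]: "(\<lambda>x. card (top1_selected a (i - 1) (fst x) (snd x)))
      \<in> R \<Otimes>\<^sub>M history_space i \<rightarrow>\<^sub>M count_space UNIV"
    by (rule measurable_card_top1_selected[OF a measurable_fst])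
       (use i in \<open>auto intro!: measurable_compose[OF measurable_snd measurable_component_singleton]\<close>)
  have [measurable]: "(\<lambda>x. a i (fst x) (snd x)) \<in> R \<Otimes>\<^sub>M history_space i \<rightarrow>\<^sub>M count_space UNIV"
    using a[OF i] by (simp add: case_prod_beta)
  show ?thesis
    unfolding cap_def case_prod_beta by measurable
qed

text \<open>Transcripts form a countable type, so a rule that is measurable for each fixed
  transcript stays measurable when the random transcript is inserted.\<close>

lemma measurable_run:
  assumes q: "\<And>i t. i \<in> {1..k} \<Longrightarrow>
      (\<lambda>(s, h). q i s h t) \<in> R \<Otimes>\<^sub>M history_space i \<rightarrow>\<^sub>M count_space UNIV"
    and f: "f \<in> N \<rightarrow>\<^sub>M R"
    and g: "\<And>j. j \<in> {1..k} \<Longrightarrow> (\<lambda>\<omega>. g \<omega> j) \<in> borel_measurable N"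
    and ans: "\<And>j. j \<in> {1..k} \<Longrightarrow> Measurable.pred N (\<lambda>\<omega>. ans \<omega> j)"
  shows "(\<lambda>\<omega>. run q (ans \<omega>) (f \<omega>) (g \<omega>) k) \<in> N \<rightarrow>\<^sub>M count_space UNIV"
  using q g ans
proof (induction k)
  case (Suc k)
  have [measurable]: "(\<lambda>\<omega>. run q (ans \<omega>) (f \<omega>) (g \<omega>) k) \<in> N \<rightarrow>\<^sub>M count_space UNIV"
    by (rule Suc.IH) (use Suc.prems in auto)
  have [measurable]: "Measurable.pred N (\<lambda>\<omega>. ans \<omega> (Suc k))"
    using Suc.prems(3) by simp
  have "Measurable.pred N (\<lambda>\<omega>. q (Suc k) (f \<omega>) (restrict (g \<omega>) {1..Suc k}) t)" for t
    by (rule pred_rule[OF Suc.prems(1) f Suc.prems(2)]) auto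
  then have [measurable]: "Measurable.pred N (\<lambda>\<omega>. q (Suc k) (f \<omega>) (restrict (g \<omega>) {1..Suc k})
      (run q (ans \<omega>) (f \<omega>) (g \<omega>) k))"
    by (rule measurable_compose_countable) measurable
  have "(\<lambda>\<omega>. (\<lambda>t b. t @ [b]) (run q (ans \<omega>) (f \<omega>) (g \<omega>) k)
      (if q (Suc k) (f \<omega>) (restrict (g \<omega>) {1..Suc k}) (run q (ans \<omega>) (f \<omega>) (g \<omega>) k)
       then Some (ans \<omega> (Suc k)) else None)) \<in> N \<rightarrow>\<^sub>M count_space UNIV"
    by measurable
  then show ?case by simp
qed simp

section \<open>Measurability of the success events\<close>

lemma pred_is_Max:
  fixes g :: "'b \<Rightarrow> nat \<Rightarrow> real"
  assumes i: "i \<in> {1..n}"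
    and g: "\<And>j. j \<in> {1..n} \<Longrightarrow> (\<lambda>\<omega>. g \<omega> j) \<in> borel_measurable N"
  shows "Measurable.pred N (\<lambda>\<omega>. g \<omega> i = Max (g \<omega> ` {1..n}))"
proof -
  have "(g \<omega> i = Max (g \<omega> ` {1..n})) \<longleftrightarrow> (\<forall>j\<in>{1..n}. g \<omega> j \<le> g \<omega> i)" for \<omega>
    using i by (subst eq_commute, subst Max_eq_iff) auto
  moreover have "Measurable.pred N (\<lambda>\<omega>. \<forall>j\<in>{1..n}. g \<omega> j \<le> g \<omega> i)"
    using g g[OF i] by (intro pred_intros_finite borel_measurable_le[folded pred_def]) auto
  ultimately show ?thesis by simp
qed

text \<open>Puts success into the same form as \<open>oracle_success\<close>, so that comparing the
  models reduces to tracking one selected index.\<close>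

lemma top1_success_iff:
  "top1_success a n s x \<longleftrightarrow> (\<exists>i\<in>top1_selected a n s x. x i = Max (x ` {1..n}))"
proof
  assume "top1_success a n s x"
  then show "\<exists>i\<in>top1_selected a n s x. x i = Max (x ` {1..n})"
    using Max_in[of "x ` top1_selected a n s x"] by (auto simp: top1_success_def)
next
  assume "\<exists>i\<in>top1_selected a n s x. x i = Max (x ` {1..n})"
  then obtain i where i: "i \<in> top1_selected a n s x" "x i = Max (x ` {1..n})" by blast
  have "Max (x ` top1_selected a n s x) \<le> Max (x ` {1..n})"
    using i(1) by (intro Max_mono) (auto simp: top1_selected_def)
  moreover have "x i \<le> Max (x ` top1_selected a n s x)"
    using i(1) by (intro Max_ge) auto
  ultimately show "top1_success a n s x"
    using i by (auto simp: top1_success_def)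
qed

lemma pred_top1_success:
  assumes alg: "top1_algorithm R n k a"
    and f: "f \<in> N \<rightarrow>\<^sub>M R"
    and g: "\<And>j. j \<in> {1..n} \<Longrightarrow> (\<lambda>\<omega>. g \<omega> j) \<in> borel_measurable N"
  shows "Measurable.pred N (\<lambda>\<omega>. top1_success a n (f \<omega>) (g \<omega>))"
proof -
  have "top1_success a n (f \<omega>) (g \<omega>) \<longleftrightarrow>
      (\<exists>i\<in>{1..n}. a i (f \<omega>) (restrict (g \<omega>) {1..i}) \<and> g \<omega> i = Max (g \<omega> ` {1..n}))" for \<omega>
    by (auto simp: top1_success_iff top1_selected_def)
  moreover have "Measurable.pred N (\<lambda>\<omega>. a i (f \<omega>) (restrict (g \<omega>) {1..i}))" if "i \<in> {1..n}" for i
    by (rule pred_rule[OF _ f g]) (use that alg in \<open>auto simp: top1_algorithm_def\<close>)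
  ultimately show ?thesis
    using pred_is_Max[of _ n g, OF _ g] by simp
qed

lemma pred_oracle_success:
  assumes alg: "oracle_algorithm R n m q a"
    and f: "f \<in> N \<rightarrow>\<^sub>M R"
    and g: "\<And>j. j \<in> {1..n} \<Longrightarrow> (\<lambda>\<omega>. g \<omega> j) \<in> borel_measurable N"
  shows "Measurable.pred N (\<lambda>\<omega>. oracle_success q a n (f \<omega>) (g \<omega>))"
proof -
  have ans: "Measurable.pred N (\<lambda>\<omega>. oracle_answer n (g \<omega>) i)" if "i \<in> {1..n}" for i
    unfolding oracle_answer_def
    using g g[OF that] that by (intro pred_intros_finite borel_measurable_pred_less) auto
  have sel: "Measurable.pred N (\<lambda>\<omega>. a i (f \<omega>) (restrict (g \<omega>) {1..i}) (transcript q n (f \<omega>) (g \<omega>) i))"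
    if i: "i \<in> {1..n}" for i
  proof (rule measurable_compose_countable
      [where f = "\<lambda>t \<omega>. a i (f \<omega>) (restrict (g \<omega>) {1..i}) t"])
    show "Measurable.pred N (\<lambda>\<omega>. a i (f \<omega>) (restrict (g \<omega>) {1..i}) t)" for t
      by (rule pred_rule[of "\<lambda>s h. a i s h t", OF _ f g])
         (use i alg in \<open>auto simp: oracle_algorithm_def\<close>)
    show "(\<lambda>\<omega>. transcript q n (f \<omega>) (g \<omega>) i) \<in> N \<rightarrow>\<^sub>M count_space UNIV"
      unfolding transcript_eq_run
      by (rule measurable_run[OF _ f g ans]) (use i alg in \<open>auto simp: oracle_algorithm_def\<close>)
  qed
  have "oracle_success q a n (f \<omega>) (g \<omega>) \<longleftrightarrow>
      (\<exists>i\<in>{1..n}. a i (f \<omega>) (restrict (g \<omega>) {1..i}) (transcript q n (f \<omega>) (g \<omega>) i) \<and>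
        g \<omega> i = Max (g \<omega> ` {1..n}))" for \<omega>
    by (auto simp: oracle_success_def oracle_selected_def)
  then show ?thesis
    using sel pred_is_Max[of _ n g, OF _ g] by simp
qed


section \<open>From the oracle model to the Top-1-of-k model\<close>

text \<open>
  The cap is needed: the all-NO transcript need not be the true one, and the query bound of
  \<open>oracle_algorithm\<close> only concerns true transcripts.
\<close>

definition all_no_rule :: "'s oracle_rule \<Rightarrow> 's oracle_rule \<Rightarrow> 's top1_rule" where
  "all_no_rule q a i s h \<longleftrightarrow>
     (let t = run q (\<lambda>_. False) s h (i - 1) in q i s h t \<or> a i s h (t @ [None]))"

text \<open>Trying only the entry \<open>None\<close> for \<open>a\<close> is enough: if
  \<open>q\<close> asks at time \<open>i\<close>, the rule selects anyway.\<close>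

lemma all_no_rule_restrict:
  "all_no_rule q a i s (restrict x {1..i}) \<longleftrightarrow>
    (let t = run q (\<lambda>_. False) s x (i - 1)
     in q i s (restrict x {1..i}) t \<or> a i s (restrict x {1..i}) (t @ [None]))"
  unfolding all_no_rule_def by (subst run_restrict) auto

lemma measurable_all_no_rule:
  assumes alg: "oracle_algorithm R n m q a" and i: "i \<in> {1..n}"
  shows "(\<lambda>(s, h). all_no_rule q a i s h) \<in> R \<Otimes>\<^sub>M history_space i \<rightarrow>\<^sub>M count_space UNIV"
proof -
  let ?N = "R \<Otimes>\<^sub>M history_space i"
  let ?t = "\<lambda>z. run q (\<lambda>_. False) (fst z) (snd z) (i - 1)"
  have t: "?t \<in> ?N \<rightarrow>\<^sub>M count_space UNIV"
    by (rule measurable_run[OF _ measurable_fst])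
       (use i alg in \<open>auto simp: oracle_algorithm_def
          intro!: measurable_compose[OF measurable_snd measurable_component_singleton]\<close>)
  have q: "Measurable.pred ?N (\<lambda>z. q i (fst z) (snd z) t)"
    and a: "Measurable.pred ?N (\<lambda>z. a i (fst z) (snd z) (t @ [None]))" for t
    using alg i unfolding oracle_algorithm_def case_prod_beta by blast+
  have [measurable]: "Measurable.pred ?N (\<lambda>z. q i (fst z) (snd z) (?t z))"
    by (rule measurable_compose_countable[OF q t])
  have [measurable]: "Measurable.pred ?N (\<lambda>z. a i (fst z) (snd z) (?t z @ [None]))"
    by (rule measurable_compose_countable[OF a t])
  show ?thesis
    unfolding all_no_rule_def Let_def case_prod_beta by measurable
qed

lemma top1_algorithm_cap_all_no_rule:
  assumes "oracle_algorithm R n m q a"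
  shows "top1_algorithm R n k (cap k (all_no_rule q a))"
  unfolding top1_algorithm_def
  by (intro conjI ballI allI card_cap_le measurable_cap[OF measurable_all_no_rule[OF assms]])

text \<open>Before the time \<open>i\<close> of a successful selection all answers are NO, so up to
  there the imitation follows the true run. Its earlier selections are then true queries, at most
  \<open>m\<close>, and the cap \<open>m + 1\<close> still admits \<open>i\<close>. Ties do no harm
  because a YES is strict.\<close>

lemma oracle_success_imp_top1_success:
  assumes alg: "oracle_algorithm R n m q a" and s: "s \<in> space R"
    and success: "oracle_success q a n s x"
  shows "top1_success (cap (m + 1) (all_no_rule q a)) n s x"
proof -
  from success obtain i where i: "i \<in> oracle_selected q a n s x" "x i = Max (x ` {1..n})"
    by (auto simp: oracle_success_def)
  then have i_in: "i \<in> {1..n}" by (auto simp: oracle_selected_def)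
  have le: "x j \<le> x i" if "j \<in> {1..n}" for j
    using that by (simp add: i(2))
  \<comment> \<open>A YES before time \<open>i\<close> would mean that a larger value has already passed.\<close>
  have no: "\<not> oracle_answer n x j" if "j < i" "1 \<le> j" for j
  proof
    assume "oracle_answer n x j"
    then have "x i < x j" using that i_in by (auto simp: oracle_answer_def)
    moreover have "x j \<le> x i" using that i_in by (intro le) auto
    ultimately show False by simp
  qed
  have run: "transcript q n s x j = run q (\<lambda>_. False) s x j" if "j < i" for j
    unfolding transcript_eq_run by (rule run_cong) (use that no in auto)
  \<comment> \<open>This reaches \<open>j = i\<close> as well, where the true answer may be YES,
    since without a query it is not recorded.\<close>
  have last: "transcript q n s x j = run q (\<lambda>_. False) s x (j - 1) @ [None]"
    if "j \<in> {1..i}" "\<not> q j s (restrict x {1..j}) (run q (\<lambda>_. False) s x (j - 1))" for j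
    using that run[of "j - 1"] run_last[of j q "oracle_answer n x" s x]
    by (auto simp: transcript_eq_run)
  have "all_no_rule q a i s (restrict x {1..i})"
  proof (cases "q i s (restrict x {1..i}) (run q (\<lambda>_. False) s x (i - 1))")
    case False
    with last[of i] i(1) i_in show ?thesis
      unfolding all_no_rule_restrict Let_def by (simp add: oracle_selected_def)
  qed (simp add: all_no_rule_restrict Let_def)
  moreover have "top1_selected (all_no_rule q a) (i - 1) s x \<subseteq> oracle_queries q n s x"
  proof
    fix j assume "j \<in> top1_selected (all_no_rule q a) (i - 1) s x"
    then have j: "j \<in> {1..i - 1}" "all_no_rule q a j s (restrict x {1..j})"
      by (auto simp: top1_selected_def)
    \<comment> \<open>Without a query the imitation agrees with the true selection rule at
      \<open>j\<close>, giving a second selection besides \<open>i\<close>.\<close>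
    have "q j s (restrict x {1..j}) (run q (\<lambda>_. False) s x (j - 1))"
    proof (rule ccontr)
      assume nq: "\<not> ?thesis"
      with j last[of j] i_in have "j \<in> oracle_selected q a n s x"
        unfolding all_no_rule_restrict Let_def by (auto simp: oracle_selected_def)
      moreover have "card (oracle_selected q a n s x) \<le> Suc 0"
        using alg s by (auto simp: oracle_algorithm_def One_nat_def)
      moreover have "finite (oracle_selected q a n s x)" by (simp add: oracle_selected_def)
      ultimately have "j = i"
        using i(1) card_le_Suc0_iff_eq by blast
      with j i_in show False by auto
    qed
    with j i_in run[of "j - 1"] show "j \<in> oracle_queries q n s x"
      by (auto simp: oracle_queries_def)
  qed
  then have "card (top1_selected (all_no_rule q a) (i - 1) s x) \<le> card (oracle_queries q n s x)"
    by (rule card_mono[rotated]) (simp add: oracle_queries_def)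
  moreover have "card (oracle_queries q n s x) \<le> m"
    using alg s by (auto simp: oracle_algorithm_def)
  ultimately have "i \<in> top1_selected (cap (m + 1) (all_no_rule q a)) n s x"
    using i_in unfolding top1_selected_def[of "cap _ _"] by (simp add: cap_restrict)
  with i(2) show ?thesis by (auto simp: top1_success_iff)
qed


section \<open>From the Top-1-of-k model to the oracle model\<close>

text \<open>\<open>butlast t\<close> holds the earlier answers and \<open>last t\<close> the current
  one. With \<open>m\<close> earlier selections of \<open>a\<close> the queries are used up, and the
  current selection is the last that a bound of \<open>m + 1\<close> permits.\<close>

definition accept_rule :: "nat \<Rightarrow> 's top1_rule \<Rightarrow> 's oracle_rule" where
  "accept_rule m a i s h t \<longleftrightarrow> a i s h \<and> Some True \<notin> set (butlast t) \<and>
     (last t = Some True \<or> m \<le> card (top1_selected a (i - 1) s h))"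

abbreviation query_rule :: "nat \<Rightarrow> 's top1_rule \<Rightarrow> 's oracle_rule" where
  "query_rule m a \<equiv> \<lambda>i s h t. cap m a i s h"

text \<open>The answer at \<open>i\<close> may be mentioned even if it was not asked for: a
  selection of \<open>a\<close> that is not queried has at least \<open>m\<close> predecessors, so
  the second disjunct holds anyway.\<close>

lemma oracle_selected_accept_rule:
  "i \<in> oracle_selected (query_rule m a) (accept_rule m a) n s x \<longleftrightarrow>
    i \<in> top1_selected a n s x \<and>
    Some True \<notin> set (transcript (query_rule m a) n s x (i - 1)) \<and>
    (oracle_answer n x i \<or> m \<le> card (top1_selected a (i - 1) s x))"
proof (cases "i \<in> {1..n}")
  case True
  then have "butlast (transcript (query_rule m a) n s x i) = transcript (query_rule m a) n s x (i - 1)"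
    and "last (transcript (query_rule m a) n s x i) =
      (if cap m a i s (restrict x {1..i}) then Some (oracle_answer n x i) else None)"
    using run_last[of i "query_rule m a" "oracle_answer n x" s x] by (auto simp: transcript_eq_run)
  moreover have "top1_selected a (i - 1) s (restrict x {1..i}) = top1_selected a (i - 1) s x"
    by (rule top1_selected_restrict) simp
  ultimately show ?thesis
    using True unfolding oracle_selected_def top1_selected_def[of a n] accept_rule_def
    by (auto simp: cap_restrict)
qed (auto simp: oracle_selected_def top1_selected_def)

lemma oracle_algorithm_accept_rule:
  assumes alg: "top1_algorithm R n (m + 1) a"
  shows "oracle_algorithm R n m (query_rule m a) (accept_rule m a)"
  unfolding oracle_algorithm_def
proof (intro conjI ballI allI)
  have a: "(\<lambda>(s, h). a i s h) \<in> R \<Otimes>\<^sub>M history_space i \<rightarrow>\<^sub>M count_space UNIV" if "i \<in> {1..n}" for i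
    using alg that by (auto simp: top1_algorithm_def)
  fix i and t :: "bool option list" assume i: "i \<in> {1..n}"
  show "(\<lambda>(s, h). cap m a i s h) \<in> R \<Otimes>\<^sub>M history_space i \<rightarrow>\<^sub>M count_space UNIV"
    by (rule measurable_cap[OF a i])
  have [measurable]: "(\<lambda>x. card (top1_selected a (i - 1) (fst x) (snd x)))
      \<in> R \<Otimes>\<^sub>M history_space i \<rightarrow>\<^sub>M count_space UNIV"
    by (rule measurable_card_top1_selected[OF a measurable_fst])
       (use i in \<open>auto intro!: measurable_compose[OF measurable_snd measurable_component_singleton]\<close>)
  have [measurable]: "(\<lambda>x. a i (fst x) (snd x)) \<in> R \<Otimes>\<^sub>M history_space i \<rightarrow>\<^sub>M count_space UNIV"
    using a[OF i] by (simp add: case_prod_beta)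
  show "(\<lambda>(s, h). accept_rule m a i s h t) \<in> R \<Otimes>\<^sub>M history_space i \<rightarrow>\<^sub>M count_space UNIV"
    unfolding accept_rule_def case_prod_beta by measurable
next
  fix s and x :: "nat \<Rightarrow> real" assume s: "s \<in> space R"
  have "oracle_queries (query_rule m a) n s x = top1_selected (cap m a) n s x"
    by (auto simp: oracle_queries_def top1_selected_def[of "cap m a"])
  then show "card (oracle_queries (query_rule m a) n s x) \<le> m"
    using card_cap_le by simp
  have unique: False
    if sel: "i \<in> oracle_selected (query_rule m a) (accept_rule m a) n s x"
      "j \<in> oracle_selected (query_rule m a) (accept_rule m a) n s x" and "i < j" for i j
  proof (cases "m \<le> card (top1_selected a (i - 1) s x)")
    case True
    \<comment> \<open>\<open>i\<close> is at least the (m+1)-st selection of \<open>a\<close>, so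
      \<open>j\<close> would be at least the (m+2)-nd.\<close>
    have "card (top1_selected a (i - 1) s x) < card (top1_selected a (j - 1) s x)"
      "card (top1_selected a (j - 1) s x) < card (top1_selected a n s x)"
      using sel \<open>i < j\<close> unfolding oracle_selected_accept_rule
      by (blast intro: card_prev_less card_prev_less_total)+
    moreover have "card (top1_selected a n s x) \<le> m + 1"
      using alg s by (auto simp: top1_algorithm_def)
    ultimately show False using True by linarith
  next
    case False
    \<comment> \<open>With fewer than \<open>m\<close> predecessors, \<open>i\<close> was queried
      and got YES; this entry stays in the transcript and blocks \<open>j\<close>.\<close>
    have i: "i \<in> {1..n}" "cap m a i s (restrict x {1..i})" "oracle_answer n x i"
      using sel(1) False unfolding oracle_selected_accept_rule cap_restrict
      by (auto simp: top1_selected_def[of a n])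
    then have "Some True \<in> set (transcript (query_rule m a) n s x i)"
      unfolding transcript_eq_run by (subst run_last) auto
    moreover have "set (transcript (query_rule m a) n s x i)
        \<subseteq> set (transcript (query_rule m a) n s x (j - 1))"
      unfolding transcript_eq_run using \<open>i < j\<close> by (intro run_prefix) auto
    ultimately show False
      using sel(2) unfolding oracle_selected_accept_rule by blast
  qed
  have "finite (oracle_selected (query_rule m a) (accept_rule m a) n s x)"
    by (simp add: oracle_selected_def)
  then show "card (oracle_selected (query_rule m a) (accept_rule m a) n s x) \<le> 1"
    unfolding One_nat_def using unique by (subst card_le_Suc0_iff_eq) (blast intro: linorder_neqE_nat)+
qed

text \<open>Up to the time of the maximum, only the maximum itself gets YES. Injectivity excludes an
  equal later value, which would turn this answer into NO.\<close>

lemma top1_success_imp_oracle_success: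
  assumes inj: "inj_on x {1..n}" and success: "top1_success a n s x"
  shows "oracle_success (query_rule m a) (accept_rule m a) n s x"
proof -
  from success obtain i where i: "i \<in> top1_selected a n s x" "x i = Max (x ` {1..n})"
    by (auto simp: top1_success_iff)
  then have i_in: "i \<in> {1..n}" by (auto simp: top1_selected_def)
  have less: "x j < x i" if "j \<in> {1..n}" "j \<noteq> i" for j
  proof -
    have "x j \<le> x i" using that by (simp add: i(2))
    moreover have "x j \<noteq> x i" using inj that i_in by (auto dest: inj_onD)
    ultimately show ?thesis by simp
  qed
  have "oracle_answer n x i"
    using i_in less by (auto simp: oracle_answer_def)
  moreover have "\<not> oracle_answer n x j" if "j \<in> {1..i - 1}" for j
  proof
    assume "oracle_answer n x j"
    then have "x i < x j" using that i_in by (auto simp: oracle_answer_def)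
    moreover have "x j < x i" using that i_in by (intro less) auto
    ultimately show False by simp
  qed
  then have "Some True \<notin> set (transcript (query_rule m a) n s x (i - 1))"
    unfolding transcript_eq_run by (auto dest!: Some_True_in_run)
  ultimately have "i \<in> oracle_selected (query_rule m a) (accept_rule m a) n s x"
    using i(1) unfolding oracle_selected_accept_rule by blast
  with i(2) show ?thesis by (auto simp: oracle_success_def)
qed


section \<open>Ties and the comparison of the two values\<close>

text \<open>Independence makes the joint law a product. A continuous distribution function leaves
  \<open>Y\<close> without an atom at any fixed \<open>x\<close>, and Fubini then makes the diagonal
  null.\<close>

lemma (in prob_space) AE_indep_neq:
  fixes X Y :: "'a \<Rightarrow> real"
  assumes indep: "indep_var borel X borel Y"
    and cont: "continuous_on UNIV (cdf (distr M borel Y))"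
  shows "AE \<omega> in M. X \<omega> \<noteq> Y \<omega>"
proof -
  have X [measurable]: "random_variable borel X" and Y [measurable]: "random_variable borel Y"
    and eq: "distr M borel X \<Otimes>\<^sub>M distr M borel Y = distr M (borel \<Otimes>\<^sub>M borel) (\<lambda>\<omega>. (X \<omega>, Y \<omega>))"
    using indep by (auto simp: indep_var_distribution_eq)
  interpret DX: prob_space "distr M borel X" by (rule prob_space_distr) fact
  interpret DY: prob_space "distr M borel Y" by (rule prob_space_distr) fact
  interpret RY: real_distribution "distr M borel Y" by (rule real_distribution_distr) fact
  interpret P: pair_prob_space "distr M borel X" "distr M borel Y" ..
  have "AE y in distr M borel Y. x \<noteq> y" for x
  proof (rule AE_I[where N = "{x}"])
    have "isCont (cdf (distr M borel Y)) x"
      using cont by (simp add: continuous_on_eq_continuous_at)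
    then show "emeasure (distr M borel Y) {x} = 0"
      by (simp add: RY.isCont_cdf DY.emeasure_eq_measure)
  qed auto
  then have "AE z in distr M borel X \<Otimes>\<^sub>M distr M borel Y. fst z \<noteq> snd z"
    by (intro P.AE_pair_measure borel_measurable_neq) auto
  then show ?thesis
    unfolding eq by (subst (asm) AE_distr_iff) auto
qed

lemma (in prob_space) AE_inj_on:
  fixes X :: "nat \<Rightarrow> 'a \<Rightarrow> real"
  assumes indep: "indep_vars (\<lambda>_. borel) X I" and I: "finite I"
    and cont: "\<And>i. i \<in> I \<Longrightarrow> continuous_on UNIV (cdf (distr M borel (X i)))"
  shows "AE \<omega> in M. inj_on (\<lambda>i. X i \<omega>) I"
proof -
  have "AE \<omega> in M. X i \<omega> \<noteq> X j \<omega>" if ij: "i \<in> I" "j \<in> I" "i \<noteq> j" for i j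
  proof (rule AE_indep_neq)
    \<comment> \<open>The family is restricted to \<open>{i}\<close> and \<open>{j}\<close>, then
      composed with the coordinate maps.\<close>
    show "indep_var borel (X i) borel (X j)"
      using indep_var_compose[OF indep_var_restrict[OF indep, of "{i}" "{j}"],
          of "\<lambda>f. f i" borel "\<lambda>f. f j" borel] ij
      by (simp add: comp_def measurable_component_singleton)
  qed (use cont ij in auto)
  then have "AE \<omega> in M. \<forall>i\<in>I. \<forall>j\<in>I. i \<noteq> j \<longrightarrow> X i \<omega> \<noteq> X j \<omega>"
    using I by (intro AE_finite_allI AE_impI) auto
  then show ?thesis
    by eventually_elim (auto simp: inj_on_def)
qed

section \<open>Comparison of the two suprema\<close>

theorem theorem2p3:
  fixes M :: "'a measure" and R :: "'s measure"
    and X :: "nat \<Rightarrow> 'a \<Rightarrow> real" and n m :: nat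
  assumes "prob_space M" and "prob_space R"
    and "n \<ge> 1" and "m \<ge> 1"
    and "prob_space.indep_vars M (\<lambda>_. borel) X {1..n}"
    and "\<And>i. i \<in> {1..n} \<Longrightarrow> continuous_on UNIV (cdf (distr M borel (X i)))"
  shows "oracle_value R M X n m = top1_value R M X n (m + 1)"
proof -
  interpret M: prob_space M by fact
  interpret R: prob_space R by fact
  interpret RM: pair_prob_space R M ..
  let ?P = "R \<Otimes>\<^sub>M M"
  let ?x = "\<lambda>z i. X i (snd z)"
  have X: "(\<lambda>z. ?x z i) \<in> borel_measurable ?P" if "i \<in> {1..n}" for i
    using assms(5) that by (intro measurable_compose[OF measurable_snd]) (auto simp: M.indep_vars_def)
  \<comment> \<open>Measurability of this event lets the almost sure statement on \<open>M\<close>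
    pass to the product with the seed space.\<close>
  have "Measurable.pred ?P (\<lambda>z. inj_on (?x z) {1..n})"
    unfolding inj_on_def using X by
      (intro pred_intros_finite pred_intros_logic borel_measurable_eq[folded pred_def]) auto
  moreover have "AE \<omega> in M. inj_on (\<lambda>i. X i \<omega>) {1..n}"
    by (rule M.AE_inj_on) (use assms in auto)
  ultimately have inj: "AE z in ?P. inj_on (?x z) {1..n}"
    by (intro RM.AE_pair_measure) (simp_all add: pred_def)
  have split: "\<P>((s, \<omega>) in ?P. f s \<omega>) = \<P>(z in ?P. f (fst z) (snd z))" for f
    by (rule arg_cong[where f = "measure ?P"]) auto
  define O1 where "O1 = {\<P>((s, \<omega>) in ?P. oracle_success q a n s (\<lambda>i. X i \<omega>)) | q a.
      oracle_algorithm R n m q a}"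
  define T1 where "T1 = {\<P>((s, \<omega>) in ?P. top1_success a n s (\<lambda>i. X i \<omega>)) | a.
      top1_algorithm R n (m + 1) a}"
  \<comment> \<open>The inclusion of events holds at every sample point, with the same seed, so
    plain monotonicity of the measure suffices.\<close>
  have OT: "\<exists>v\<in>T1. u \<le> v" if "u \<in> O1" for u
  proof -
    obtain q a where alg: "oracle_algorithm R n m q a"
      and u: "u = \<P>((s, \<omega>) in ?P. oracle_success q a n s (\<lambda>i. X i \<omega>))"
      using \<open>u \<in> O1\<close> unfolding O1_def by blast
    let ?b = "cap (m + 1) (all_no_rule q a)"
    have alg': "top1_algorithm R n (m + 1) ?b" by (rule top1_algorithm_cap_all_no_rule[OF alg])
    have "u \<le> \<P>((s, \<omega>) in ?P. top1_success ?b n s (\<lambda>i. X i \<omega>))"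
      unfolding u split
    proof (rule RM.finite_measure_mono)
      show "{z \<in> space ?P. top1_success ?b n (fst z) (?x z)} \<in> sets ?P"
        using pred_top1_success[OF alg' measurable_fst X] unfolding pred_def .
    qed (use oracle_success_imp_top1_success[OF alg] in \<open>auto simp: space_pair_measure\<close>)
    with alg' show ?thesis unfolding T1_def by blast
  qed
  \<comment> \<open>Here the inclusion of events may fail on ties, hence it is used only almost
    everywhere.\<close>
  have TO: "\<exists>v\<in>O1. u \<le> v" if "u \<in> T1" for u
  proof -
    obtain a where alg: "top1_algorithm R n (m + 1) a"
      and u: "u = \<P>((s, \<omega>) in ?P. top1_success a n s (\<lambda>i. X i \<omega>))"
      using \<open>u \<in> T1\<close> unfolding T1_def by blast
    let ?q = "query_rule m a" and ?b = "accept_rule m a"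
    have alg': "oracle_algorithm R n m ?q ?b" by (rule oracle_algorithm_accept_rule[OF alg])
    have "u \<le> \<P>((s, \<omega>) in ?P. oracle_success ?q ?b n s (\<lambda>i. X i \<omega>))"
      unfolding u split
    proof (rule RM.finite_measure_mono_AE)
      show "{z \<in> space ?P. oracle_success ?q ?b n (fst z) (?x z)} \<in> sets ?P"
        using pred_oracle_success[OF alg' measurable_fst X] unfolding pred_def .
      show "AE z in ?P. z \<in> {z \<in> space ?P. top1_success a n (fst z) (?x z)} \<longrightarrow>
          z \<in> {z \<in> space ?P. oracle_success ?q ?b n (fst z) (?x z)}"
        using inj by eventually_elim (auto intro: top1_success_imp_oracle_success)
    qed
    with alg' show ?thesis unfolding O1_def by blast
  qed
  \<comment> \<open>Real suprema behave well only for nonempty bounded sets: the rule that never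
    selects provides an element, and 1 is a bound.\<close>
  have "top1_algorithm R n (m + 1) (\<lambda>_ _ _. False)"
    by (simp add: top1_algorithm_def top1_selected_def)
  then have "T1 \<noteq> {}" unfolding T1_def by blast
  moreover from this have "O1 \<noteq> {}" using TO by blast
  moreover have "bdd_above O1" "bdd_above T1"
    unfolding O1_def T1_def by (auto intro!: bdd_aboveI[where M = 1])
  \<comment> \<open>Mutual domination of the two sets is enough; neither supremum has to be
    attained.\<close>
  ultimately have "Sup O1 = Sup T1"
    using OT TO by (intro antisym cSup_mono) auto
  then show ?thesis
    by (simp add: oracle_value_def top1_value_def O1_def T1_def)
qed

end
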